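(* Let $t_1\in(0,1)$, $q\in[0,1]$, $s\ge 1$, $c_1>0$, $c_2>0$, with $q\neq 1$ and $qs+q-1\neq 0$. Let $p(x)=\frac1x$ for $x>0$, $F(x)=\frac12 s t_1x^2$, and $C_i(x_i)=c_ix_i$ for $i=1,2$. Consider the system of four equations in the unknowns $(x_1,x_2,z_1,z_2)$ (with $x_i\ge 0$, $x_1+x_2>0$, $0\le z_i\le x_ip(x_1+x_2)$) $$\left[1-qt_1-qF'\left(x_ip(x_1+x_2)-z_i\right)\right]\left[p(x_1+x_2)+x_ip'(x_1+x_2)\right]-C_i'(x_i)=0,\quad i=1,2,$$ $$-(1-q)t_1+qF'\left(x_ip(x_1+x_2)-z_i\right)=0,\quad i=1,2.$$ If $$\frac{1-q}{qs+q-1}\,c_1\le c_2\le \frac{qs+q-1}{1-q}\,c_1,$$ then the solution of this system is given by $$x_1^*=\frac{c_2(1-t_1)}{(c_1+c_2)^2},\quad x_2^*=\frac{c_1(1-t_1)}{(c_1+c_2)^2},\quad z_1^*=\frac{c_2}{c_1+c_2}-\frac{1-q}{qs},\quad z_2^*=\frac{c_1}{c_1+c_2}-\frac{1-q}{qs}.$$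
   Context: Cournot duopoly with tax evasion: firm $i\in\{1,2\}$ chooses output $x_i\ge 0$ and declared revenue $z_i\le x_ip(x_1+x_2)$, where $p$ is the inverse demand function, $C_i$ the cost function of firm $i$, $F$ the penalty function, $t_1$ the ad valorem tax rate, and $q$ the probability that evasion is detected. The profit of firm $i$ is $$P_i=(1-q)\left[x_ip(x_1+x_2)-C_i(x_i)-t_1z_i\right]+q\left[(1-t_1)x_ip(x_1+x_2)-C_i(x_i)-F\left(x_ip(x_1+x_2)-z_i\right)\right].$$ The system in the claim is the system of first-order conditions $\partial P_i/\partial x_i=0$, $\partial P_i/\partial z_i=0$, $i=1,2$, in which each firm maximizes its own profit $P_i$ over $(x_i,z_i)$. *)

theory Defs
  imports "HOL-Analysis.Analysis"
begin

text \<open>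
  Throughout, \<open>x\<close>, \<open>y\<close>, \<open>z\<close> are a firm's own output, its rival's output and its own
  declared revenue; \<open>p\<close> is the inverse demand, \<open>C\<close> the firm's cost, \<open>F\<close> the penalty,
  \<open>t\<close> the tax rate and \<open>q\<close> the detection probability.
\<close>

definition profit ::
  "real \<Rightarrow> real \<Rightarrow> (real \<Rightarrow> real) \<Rightarrow> (real \<Rightarrow> real) \<Rightarrow> (real \<Rightarrow> real) \<Rightarrow> real \<Rightarrow> real \<Rightarrow> real \<Rightarrow> real"
where
  "profit q t p F C x y z =
     (1 - q) * (x * p (x + y) - C x - t * z) +
     q * ((1 - t) * (x * p (x + y)) - C x - F (x * p (x + y) - z))"

definition output_foc ::
  "real \<Rightarrow> real \<Rightarrow> (real \<Rightarrow> real) \<Rightarrow> (real \<Rightarrow> real) \<Rightarrow> (real \<Rightarrow> real) \<Rightarrow> real \<Rightarrow> real \<Rightarrow> real \<Rightarrow> real"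
where
  "output_foc q t p F C x y z =
     (1 - q * t - q * deriv F (x * p (x + y) - z)) * (p (x + y) + x * deriv p (x + y)) - deriv C x"

definition declaration_foc ::
  "real \<Rightarrow> real \<Rightarrow> (real \<Rightarrow> real) \<Rightarrow> (real \<Rightarrow> real) \<Rightarrow> real \<Rightarrow> real \<Rightarrow> real \<Rightarrow> real"
where
  "declaration_foc q t p F x y z = - (1 - q) * t + q * deriv F (x * p (x + y) - z)"

text \<open>These expressions are the partial derivatives of the firm's own profit.\<close>

lemma profit_has_derivative_output:
  assumes "p differentiable at (x + y)" "C differentiable at x"
    and "F differentiable at (x * p (x + y) - z)"
  shows "((\<lambda>u. profit q t p F C u y z) has_real_derivative output_foc q t p F C x y z) (at x)"
proof -
  have p: "(p has_real_derivative deriv p (x + y)) (at (x + y))"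
    and C: "(C has_real_derivative deriv C x) (at x)"
    and F: "(F has_real_derivative deriv F (x * p (x + y) - z)) (at (x * p (x + y) - z))"
    using assms DERIV_deriv_iff_real_differentiable by blast+
  have p': "((\<lambda>u. p (u + y)) has_real_derivative deriv p (x + y)) (at x)"
    using p by (simp add: DERIV_shift)
  have R: "((\<lambda>u. u * p (u + y)) has_real_derivative p (x + y) + x * deriv p (x + y)) (at x)"
    by (rule derivative_eq_intros p' refl | simp)+
  have F': "((\<lambda>u. F (u * p (u + y) - z)) has_real_derivative
      deriv F (x * p (x + y) - z) * (p (x + y) + x * deriv p (x + y))) (at x)"
    by (rule DERIV_chain2[where f = F and g = "\<lambda>u. u * p (u + y) - z"]) (use F p' in \<open>auto intro!: derivative_eq_intros\<close>)
  show ?thesis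
    unfolding profit_def output_foc_def
    by (rule derivative_eq_intros R C F' refl)+ (simp add: algebra_simps)
qed

lemma profit_has_derivative_declaration:
  assumes "F differentiable at (x * p (x + y) - z)"
  shows "((\<lambda>w. profit q t p F C x y w) has_real_derivative declaration_foc q t p F x y z) (at z)"
proof -
  have F: "(F has_real_derivative deriv F (x * p (x + y) - z)) (at (x * p (x + y) - z))"
    using assms DERIV_deriv_iff_real_differentiable by blast
  have F': "((\<lambda>w. F (x * p (x + y) - w)) has_real_derivative
      deriv F (x * p (x + y) - z) * (- 1)) (at z)"
    by (rule DERIV_chain2[where f = F and g = "\<lambda>w. x * p (x + y) - w"]) (use F in \<open>auto intro!: derivative_eq_intros\<close>)
  show ?thesis
    unfolding profit_def declaration_foc_def
    by (rule derivative_eq_intros F' refl)+ (simp add: algebra_simps)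
qed

definition foc_solutions ::
  "real \<Rightarrow> real \<Rightarrow> (real \<Rightarrow> real) \<Rightarrow> (real \<Rightarrow> real) \<Rightarrow> (real \<Rightarrow> real) \<Rightarrow> (real \<Rightarrow> real) \<Rightarrow>
     (real \<times> real \<times> real \<times> real) set"
where
  "foc_solutions q t p F C1 C2 =
     {(x1, x2, z1, z2).
        0 \<le> x1 \<and> 0 \<le> x2 \<and> 0 < x1 + x2 \<and>
        0 \<le> z1 \<and> z1 \<le> x1 * p (x1 + x2) \<and>
        0 \<le> z2 \<and> z2 \<le> x2 * p (x1 + x2) \<and>
        output_foc q t p F C1 x1 x2 z1 = 0 \<and>
        output_foc q t p F C2 x2 x1 z2 = 0 \<and>
        declaration_foc q t p F x1 x2 z1 = 0 \<and>
        declaration_foc q t p F x2 x1 z2 = 0}"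

end

theory Submission
  imports Defs
begin

text \<open>
  The system decouples. With a quadratic penalty the declaration condition is linear in the
  undeclared revenue \<open>r - z\<close> and fixes it at \<open>(1 - q) / (q * s)\<close>, whatever the outputs are. At
  this level the expected marginal penalty \<open>q * F'\<close> equals \<open>(1 - q) * t\<close>, so the factor in front of
  marginal revenue in the output condition collapses to \<open>1 - q * t - (1 - q) * t = 1 - t\<close>: evasion
  leaves the outputs exactly those of a Cournot duopoly taxed at the rate \<open>t\<close> with honest firms.
  This is the content of \<open>firm_foc_iff\<close>.

  Under unit-elastic demand a firm's marginal revenue is its rival's output over the squared total
  output \<open>X\<close>. Adding the two remaining conditions gives \<open>(1 - t) / X = c1 + c2\<close>, hence \<open>X\<close> and then
  both outputs (\<open>cournot_outputs_iff\<close>). Each firm's revenue is its market share, that is its rival's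
  share of total marginal cost.

  What is left is feasibility. The upper bound on \<open>z\<close> says that undeclared revenue is nonnegative.
  The lower bounds \<open>z1 \<ge> 0\<close> and \<open>z2 \<ge> 0\<close> are, after clearing denominators, precisely the two
  assumed bounds on \<open>c2 / c1\<close>; these bounds also force \<open>q * s + q - 1 > 0\<close> and \<open>q > 0\<close>, since \<open>c1\<close>
  and \<open>c2\<close> are positive.
\<close>

lemma deriv_unit_elastic_demand:
  fixes p :: "real \<Rightarrow> real"
  assumes p: "\<And>x. 0 < x \<Longrightarrow> p x = 1 / x" and X: "0 < X"
  shows "deriv p X = - (1 / X ^ 2)"
proof -
  have "((\<lambda>x. 1 / x) has_real_derivative - (1 / X ^ 2)) (at X)"
    using X by (auto intro!: derivative_eq_intros simp: power2_eq_square)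
  then have "(p has_real_derivative - (1 / X ^ 2)) (at X)"
    by (rule has_field_derivative_transform_within_open[where S = "{0<..}"]) (use p X in auto)
  then show ?thesis
    by (rule DERIV_imp_deriv)
qed

lemma deriv_quadratic_penalty:
  fixes F :: "real \<Rightarrow> real"
  assumes "\<And>x. F x = 1 / 2 * s * t * x ^ 2"
  shows "deriv F x = s * t * x"
proof -
  have "F = (\<lambda>x. 1 / 2 * s * t * x ^ 2)"
    using assms by blast
  then have "(F has_real_derivative s * t * x) (at x)"
    by (auto intro!: derivative_eq_intros)
  then show ?thesis
    by (rule DERIV_imp_deriv)
qed

lemma deriv_linear_cost:
  fixes C :: "real \<Rightarrow> real"
  assumes "\<And>x. C x = c * x"
  shows "deriv C x = c"
proof -
  have "C = (\<lambda>x. c * x)"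
    using assms by blast
  then show ?thesis
    by simp
qed

text \<open>
  The declaration condition determines \<open>q * F'\<close>, and substituting it into the output condition
  eliminates the penalty and the detection probability from the latter.
\<close>

lemma firm_foc_iff:
  fixes p F C :: "real \<Rightarrow> real"
  assumes p: "\<And>x. 0 < x \<Longrightarrow> p x = 1 / x"
    and F: "\<And>x. F x = 1 / 2 * s * t * x ^ 2"
    and C: "\<And>x. C x = c * x"
    and pos: "0 < x + y" "0 < q" "0 < s" "0 < t"
  shows "output_foc q t p F C x y z = 0 \<and> declaration_foc q t p F x y z = 0 \<longleftrightarrow>
    (1 - t) * y = c * (x + y) ^ 2 \<and> z = x / (x + y) - (1 - q) / (q * s)"
proof -
  define u where "u = x / (x + y) - z"
  have price: "x * p (x + y) = x / (x + y)"
    using p pos by simp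
  have "declaration_foc q t p F x y z = t * (q * s * u - (1 - q))"
    unfolding declaration_foc_def price deriv_quadratic_penalty[OF F] u_def
    by (simp add: algebra_simps)
  then have "declaration_foc q t p F x y z = 0 \<longleftrightarrow> q * s * u = 1 - q"
    using pos by simp
  also have "\<dots> \<longleftrightarrow> u = (1 - q) / (q * s)"
    using pos by (simp add: eq_divide_eq mult.commute)
  finally have decl: "declaration_foc q t p F x y z = 0 \<longleftrightarrow> u = (1 - q) / (q * s)" .
  have revenue: "p (x + y) + x * deriv p (x + y) = y / (x + y) ^ 2"
  proof -
    have "p (x + y) + x * deriv p (x + y) = (x + y) / (x + y) ^ 2 - x / (x + y) ^ 2"
      using p pos by (simp add: deriv_unit_elastic_demand[OF p] power2_eq_square)
    then show ?thesis
      by (simp add: diff_divide_distrib[symmetric])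
  qed
  have out: "output_foc q t p F C x y z = 0 \<longleftrightarrow> (1 - t) * y = c * (x + y) ^ 2"
    if "u = (1 - q) / (q * s)"
  proof -
    have "q * s * u = 1 - q"
      using that pos by simp
    then have "q * (s * t * u) = (1 - q) * t"
      by (metis mult.assoc mult.commute)
    then have "1 - q * t - q * (s * t * u) = 1 - t"
      by (simp add: algebra_simps)
    then have "output_foc q t p F C x y z = (1 - t) * (y / (x + y) ^ 2) - c"
      unfolding output_foc_def revenue
      unfolding price deriv_quadratic_penalty[OF F] deriv_linear_cost[OF C] u_def by simp
    then show ?thesis
      using pos by (simp add: divide_eq_eq)
  qed
  have "u = (1 - q) / (q * s) \<longleftrightarrow> z = x / (x + y) - (1 - q) / (q * s)"
    unfolding u_def by auto
  then show ?thesis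
    using decl out by blast
qed

lemma cournot_total_output:
  fixes k c1 c2 :: real
  assumes "0 < c1 + c2"
  shows "c2 * k / (c1 + c2) ^ 2 + c1 * k / (c1 + c2) ^ 2 = k / (c1 + c2)"
proof -
  have "c2 * k / (c1 + c2) ^ 2 + c1 * k / (c1 + c2) ^ 2 = ((c1 + c2) * k) / (c1 + c2) ^ 2"
    by (simp add: add_divide_distrib[symmetric] algebra_simps)
  then show ?thesis
    using assms by (simp add: power2_eq_square)
qed

text \<open>
  The sum of the two conditions is \<open>k * X = (c1 + c2) * X ^ 2\<close> for the total output \<open>X\<close>; cancelling
  \<open>X > 0\<close> determines \<open>X\<close>, after which each condition is linear in a single output.
\<close>

lemma cournot_outputs_iff:
  fixes k c1 c2 x1 x2 :: real
  assumes "0 < c1 + c2" "0 < k"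
  shows "0 < x1 + x2 \<and> k * x2 = c1 * (x1 + x2) ^ 2 \<and> k * x1 = c2 * (x1 + x2) ^ 2 \<longleftrightarrow>
    x1 = c2 * k / (c1 + c2) ^ 2 \<and> x2 = c1 * k / (c1 + c2) ^ 2"
    (is "?L \<longleftrightarrow> ?R")
proof
  assume L: ?L
  then have "k * (x1 + x2) = ((c1 + c2) * (x1 + x2)) * (x1 + x2)"
    by (simp add: algebra_simps power2_eq_square)
  then have "k = (c1 + c2) * (x1 + x2)"
    using L by simp
  then have X: "x1 + x2 = k / (c1 + c2)"
    using assms by (simp add: field_simps)
  have "k * x1 = k * (c2 * k / (c1 + c2) ^ 2)" "k * x2 = k * (c1 * k / (c1 + c2) ^ 2)"
    using L unfolding X by (simp_all add: power2_eq_square)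
  then show ?R
    using assms by (metis less_irrefl mult_cancel_left)
next
  assume R: ?R
  have X: "x1 + x2 = k / (c1 + c2)"
    using R cournot_total_output[of c1 c2 k] assms by simp
  show ?L
    unfolding X using R assms by (simp add: power2_eq_square)
qed

text \<open>
  With \<open>a\<close> the rival's and \<open>b\<close> the firm's own marginal cost, \<open>a / (a + b)\<close> is the firm's equilibrium
  revenue, so this is the condition for a nonnegative declaration.
\<close>

lemma declaration_nonneg_iff:
  fixes a b q s :: real
  assumes "0 < a + b" "0 < q * s"
  shows "0 \<le> a / (a + b) - (1 - q) / (q * s) \<longleftrightarrow> (1 - q) * b \<le> (q * s + q - 1) * a"
proof -
  have "0 \<le> a / (a + b) - (1 - q) / (q * s) \<longleftrightarrow> (1 - q) * (a + b) \<le> a * (q * s)"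
    using assms by (simp add: frac_le_eq divide_le_eq pos_le_divide_eq)
  also have "\<dots> \<longleftrightarrow> (1 - q) * b \<le> (q * s + q - 1) * a"
    by (simp add: algebra_simps)
  finally show ?thesis .
qed

theorem proposition2:
  fixes t1 q s c1 c2 :: real and p F C1 C2 :: "real \<Rightarrow> real"
  assumes "0 < t1" "t1 < 1" "0 \<le> q" "q \<le> 1" "1 \<le> s" "0 < c1" "0 < c2"
    and "q \<noteq> 1" and "q * s + q - 1 \<noteq> 0"
    and "\<And>x. 0 < x \<Longrightarrow> p x = 1 / x"
    and "\<And>x. F x = 1 / 2 * s * t1 * x ^ 2"
    and "\<And>x. C1 x = c1 * x"
    and "\<And>x. C2 x = c2 * x"
    and "(1 - q) / (q * s + q - 1) * c1 \<le> c2"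
    and "c2 \<le> (q * s + q - 1) / (1 - q) * c1"
  shows "foc_solutions q t1 p F C1 C2 =
    {(c2 * (1 - t1) / (c1 + c2) ^ 2,
      c1 * (1 - t1) / (c1 + c2) ^ 2,
      c2 / (c1 + c2) - (1 - q) / (q * s),
      c1 / (c1 + c2) - (1 - q) / (q * s))}"
proof -
  note p = assms(10) and F = assms(11) and C1 = assms(12) and C2 = assms(13)
  define D where "D = q * s + q - 1"
  define e where "e = (1 - q) / (q * s)"
  have q1: "0 < 1 - q"
    using assms(4,8) by simp
  have "0 < D / (1 - q) * c1"
    using assms(7,15) unfolding D_def by linarith
  then have D: "0 < D"
    using q1 assms(6) by (simp add: zero_less_mult_iff zero_less_divide_iff)
  have "q \<noteq> 0"
    using D unfolding D_def by auto
  then have q: "0 < q"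
    using assms(3) by simp
  have s: "0 < s"
    using assms(5) by simp
  have c: "0 < c1 + c2" "0 < c2 + c1"
    using assms(6,7) by simp_all
  have k: "0 < 1 - t1"
    using assms(2) by simp
  have e: "0 \<le> e"
    unfolding e_def using q1 q s by simp
  have z1: "0 \<le> c2 / (c1 + c2) - e"
  proof -
    have "(1 - q) * c1 \<le> D * c2"
      using assms(14) D unfolding D_def[symmetric] by (simp add: divide_le_eq mult.commute)
    then show ?thesis
      using declaration_nonneg_iff[of c2 c1 q s] c q s unfolding D_def e_def
      by (simp add: add.commute)
  qed
  have z2: "0 \<le> c1 / (c1 + c2) - e"
  proof -
    have "(1 - q) * c2 \<le> D * c1"
      using assms(15) q1 unfolding D_def[symmetric] by (simp add: pos_le_divide_eq mult.commute)
    then show ?thesis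
      using declaration_nonneg_iff[of c1 c2 q s] c q s unfolding D_def e_def by simp
  qed
  let ?x1 = "c2 * (1 - t1) / (c1 + c2) ^ 2" and ?x2 = "c1 * (1 - t1) / (c1 + c2) ^ 2"
  have pos: "0 \<le> ?x1" "0 \<le> ?x2"
    using assms(6,7) k by simp_all
  have total: "?x1 + ?x2 = (1 - t1) / (c1 + c2)"
    using c(1) by (rule cournot_total_output)
  have share: "?x1 / (?x1 + ?x2) = c2 / (c1 + c2)" "?x2 / (?x1 + ?x2) = c1 / (c1 + c2)"
    unfolding total using c k by (simp_all add: power2_eq_square)
  have "(x1, x2, w1, w2) \<in> foc_solutions q t1 p F C1 C2 \<longleftrightarrow>
      x1 = ?x1 \<and> x2 = ?x2 \<and> w1 = c2 / (c1 + c2) - e \<and> w2 = c1 / (c1 + c2) - e"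
    for x1 x2 w1 w2
  proof -
    have price: "x1 * p (x1 + x2) = x1 / (x1 + x2)" "x2 * p (x1 + x2) = x2 / (x1 + x2)"
      if "0 < x1 + x2"
      using p that by simp_all
    have foc1: "output_foc q t1 p F C1 x1 x2 w1 = 0 \<and> declaration_foc q t1 p F x1 x2 w1 = 0 \<longleftrightarrow>
        (1 - t1) * x2 = c1 * (x1 + x2) ^ 2 \<and> w1 = x1 / (x1 + x2) - e" if "0 < x1 + x2"
      unfolding e_def by (rule firm_foc_iff[OF p F C1 that q s assms(1)])
    have foc2: "output_foc q t1 p F C2 x2 x1 w2 = 0 \<and> declaration_foc q t1 p F x2 x1 w2 = 0 \<longleftrightarrow>
        (1 - t1) * x1 = c2 * (x1 + x2) ^ 2 \<and> w2 = x2 / (x1 + x2) - e" if "0 < x1 + x2"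
      using firm_foc_iff[OF p F C2 _ q s assms(1), of x2 x1 w2] that
      unfolding e_def by (simp add: add.commute)
    have "(x1, x2, w1, w2) \<in> foc_solutions q t1 p F C1 C2 \<longleftrightarrow>
        0 \<le> x1 \<and> 0 \<le> x2 \<and> 0 \<le> w1 \<and> 0 \<le> w2 \<and>
        w1 = x1 / (x1 + x2) - e \<and> w2 = x2 / (x1 + x2) - e \<and>
        (0 < x1 + x2 \<and> (1 - t1) * x2 = c1 * (x1 + x2) ^ 2 \<and> (1 - t1) * x1 = c2 * (x1 + x2) ^ 2)"
      unfolding foc_solutions_def using foc1 foc2 price e by auto
    also have "\<dots> \<longleftrightarrow> 0 \<le> x1 \<and> 0 \<le> x2 \<and> 0 \<le> w1 \<and> 0 \<le> w2 \<and>
        w1 = x1 / (x1 + x2) - e \<and> w2 = x2 / (x1 + x2) - e \<and> x1 = ?x1 \<and> x2 = ?x2"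
      unfolding cournot_outputs_iff[OF c(1) k] by simp
    also have "\<dots> \<longleftrightarrow>
        x1 = ?x1 \<and> x2 = ?x2 \<and> w1 = c2 / (c1 + c2) - e \<and> w2 = c1 / (c1 + c2) - e"
      using pos z1 z2 share by metis
    finally show ?thesis .
  qed
  then show ?thesis
    unfolding e_def by auto
qed

end
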